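(* Let $\mathcal{X}\in\mathbb{R}^{s_1\times\cdots\times s_N}$ be a nonzero tensor with current Tucker decomposition given by a core tensor $\mathcal{G}\in\mathbb{R}^{R_1\times\cdots\times R_N}$ and factor matrices $A^{(n)}=A_p^{(n)}+dA^{(n)}\in\mathbb{R}^{s_n\times R_n}$ with orthonormal columns, where $A_p^{(n)}$ (also with orthonormal columns) are the factor matrices at the time the pairwise perturbation operators were formed. If $\|dA^{(n)}\|_2\le\epsilon\ll1$ for all $n\in\{1,\ldots,N\}$ and $$\big\|\mathcal{X}-\mathcal{G}\times_1A^{(1)}\times_2A^{(2)}\cdots\times_NA^{(N)}\big\|_2\le\tfrac13\|\mathcal{X}\|_2,$$ then for every $n\in\{1,\ldots,N\}$ the pairwise perturbation approximation $\tilde{\mathcal{Y}}^{(n)}$ is constructed with error $$\frac{\|\tilde{\mathcal{Y}}^{(n)}-\mathcal{Y}^{(n)}\|_2}{\|\mathcal{Y}^{(n)}\|_2}=O(\epsilon^2).$$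
   Context: $\mathcal{X}\times_n B$ denotes the mode-$n$ product of a tensor with a matrix $B\in\mathbb{R}^{J\times s_n}$. Spectral norm of an order $N$ tensor: $\|\mathcal{T}\|_2=\max \|\mathcal{T}\times_2 x^{(2)T}\cdots\times_N x^{(N)T}\|_2$ over unit vectors $x^{(2)},\ldots,x^{(N)}$, where $\times_i x^{(i)T}$ is contraction of mode $i$ with $x^{(i)}$ (the norm is invariant under reordering of modes). For matrices it is the usual spectral norm. $\mathcal{Y}^{(n)}$ is $\mathcal{X}$ multiplied by $A^{(j)T}$ along every mode $j\ne n$. Let $\mathcal{Y}_p^{(n)}$ be $\mathcal{X}$ multiplied by $A_p^{(j)T}$ along every mode $j\ne n$, and $\mathcal{Y}_p^{(i,n)}$ be $\mathcal{X}$ multiplied by $A_p^{(j)T}$ along every mode $j\notin\{i,n\}$. The pairwise perturbation approximation is $$\tilde{\mathcal{Y}}^{(n)}=\mathcal{Y}_p^{(n)}+\sum_{i\neq n}\mathcal{Y}_p^{(i,n)}\times_i dA^{(i)T}.$$ $O(\epsilon^2)$ means: bounded by $C\epsilon^2$ for all sufficiently small $\epsilon$, with $C$ (and the smallness threshold) depending only on $N$. *)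

theory Defs
  imports Complex_Main "Jordan_Normal_Form.Matrix"
begin

text \<open>A tensor of order \<open>N\<close> is a function of multi-indices, which are lists of length \<open>N\<close>. Modes and
  index positions are numbered from \<open>0\<close>. The shape of a tensor is passed separately as the list \<open>d\<close>
  of its dimensions; values outside \<open>multi_indices d\<close> are irrelevant to everything below.\<close>

type_synonym tensor = "nat list \<Rightarrow> real"

definition multi_indices :: "nat list \<Rightarrow> nat list set" where
  "multi_indices d = {i. list_all2 (<) i d}"

text \<open>For \<open>B\<close> of size \<open>J \<times> (d ! n)\<close>, the product has shape \<open>d[n := J]\<close>.\<close>

definition mode_prod :: "tensor \<Rightarrow> nat \<Rightarrow> real mat \<Rightarrow> tensor" where
  "mode_prod X n B = (\<lambda>i. \<Sum>k<dim_col B. X (i[n := k]) * B $$ (i ! n, k))"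

definition mode_prods :: "tensor \<Rightarrow> nat list \<Rightarrow> (nat \<Rightarrow> real mat) \<Rightarrow> tensor" where
  "mode_prods X ms B = foldl (\<lambda>T j. mode_prod T j (B j)) X ms"

definition vec_norm2 :: "real vec \<Rightarrow> real" where
  "vec_norm2 x = sqrt (x \<bullet> x)"

definition unit_vecs :: "nat \<Rightarrow> real vec set" where
  "unit_vecs m = {x \<in> carrier_vec m. vec_norm2 x = 1}"

definition mat_norm2 :: "real mat \<Rightarrow> real" where
  "mat_norm2 A = (SUP x \<in> unit_vecs (dim_col A). vec_norm2 (A *\<^sub>v x))"

definition orthonormal_cols :: "real mat \<Rightarrow> bool" where
  "orthonormal_cols A \<longleftrightarrow> A\<^sup>T * A = 1\<^sub>m (dim_col A)"

text \<open>The tensor \<open>T\<close> of shape \<open>d\<close>, contracted with \<open>x j\<close> in every mode \<open>j\<close> except the first. Contracting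
  is multiplying by the row matrix \<open>(x j)\<^sup>T\<close>, which leaves a mode of dimension 1, so the resulting
  vector is read off at the multi-indices \<open>[k, 0, \<dots>, 0]\<close>.\<close>

definition contract_all_but_first :: "nat list \<Rightarrow> tensor \<Rightarrow> (nat \<Rightarrow> real vec) \<Rightarrow> real vec" where
  "contract_all_but_first d T x =
     vec (d ! 0) (\<lambda>k. mode_prods T [1..<length d] (\<lambda>j. mat_of_rows (d ! j) [x j])
                        (k # replicate (length d - 1) 0))"

text \<open>If \<open>d\<close> is nonempty and all dimensions are positive, the supremum ranges over a nonempty bounded
  set and is attained, by compactness.\<close>

definition tensor_norm2 :: "nat list \<Rightarrow> tensor \<Rightarrow> real" where
  "tensor_norm2 d T =
     (SUP x \<in> {x. \<forall>j\<in>{1..<length d}. x j \<in> unit_vecs (d ! j)}.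
        vec_norm2 (contract_all_but_first d T x))"

text \<open>\<open>ttm_except N S X B\<close> multiplies \<open>X\<close> by \<open>(B j)\<^sup>T\<close> along every mode \<open>j \<notin> S\<close>.
  Thus \<open>Y\<close> of the mode \<open>n\<close> is \<open>ttm_except N {n} X A\<close>, and the pairwise perturbation operators
  are \<open>ttm_except N {i, n} X Ap\<close>.\<close>

definition ttm_except :: "nat \<Rightarrow> nat set \<Rightarrow> tensor \<Rightarrow> (nat \<Rightarrow> real mat) \<Rightarrow> tensor" where
  "ttm_except N S X B = mode_prods X (filter (\<lambda>j. j \<notin> S) [0..<N]) (\<lambda>j. (B j)\<^sup>T)"

definition pp_approx ::
  "nat \<Rightarrow> nat \<Rightarrow> tensor \<Rightarrow> (nat \<Rightarrow> real mat) \<Rightarrow> (nat \<Rightarrow> real mat) \<Rightarrow> tensor" where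
  "pp_approx N n X Ap dA = (\<lambda>k. ttm_except N {n} X Ap k
     + (\<Sum>i\<in>{..<N} - {n}. mode_prod (ttm_except N {i, n} X Ap) i ((dA i)\<^sup>T) k))"

end

theory Submission
  imports Defs "HOL-Analysis.L2_Norm"
begin

text \<open>A tensor is a multilinear form whose spectral norm is its supremum on unit vectors, and multiplying
  the tensor by \<open>B\<^sup>T\<close> in a mode substitutes \<open>B v\<close> for the argument \<open>v\<close> of that mode. The error of the
  approximation is then the remainder of the first-order expansion of the form of \<open>X\<close> at \<open>A\<^sub>p v + dA v\<close>,
  at most \<open>N\<^sup>2 \<epsilon>\<^sup>2 \<parallel>X\<parallel>\<close>. For the denominator, the reconstruction \<open>Z\<close> is fixed by the projections
  \<open>P = A A\<^sup>T\<close>, so projecting \<open>X\<close> in all modes but \<open>n\<close> moves it by at most twice the residual, that is, by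
  \<open>2/3 \<parallel>X\<parallel>\<close>. Since \<open>X\<close> so projected is \<open>Y\<close> multiplied by the isometries \<open>A\<close>, it follows that
  \<open>\<parallel>X\<parallel> \<le> 3 \<parallel>Y\<parallel>\<close>.\<close>

text \<open>The inner product of \<open>T\<close> with the rank-one tensor whose factors are the
  \<open>v j\<close>. No mode is left open, so all modes enter symmetrically, whereas
  \<open>tensor_norm2\<close> singles out mode 0.\<close>

definition multilinear_form :: "nat list \<Rightarrow> tensor \<Rightarrow> (nat \<Rightarrow> real vec) \<Rightarrow> real" where
  "multilinear_form d T v = (\<Sum>i\<in>multi_indices d. T i * (\<Prod>j<length d. v j $ (i ! j)))"

section \<open>Euclidean norms, the matrix norm, and matrices with orthonormal columns\<close>

lemma vec_norm2_eq_L2_set: "vec_norm2 x = L2_set (($) x) {..<dim_vec x}"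
  unfolding vec_norm2_def L2_set_def scalar_prod_def
  by (simp add: power2_eq_square lessThan_atLeast0)

lemma vec_norm2_nonneg [simp]: "0 \<le> vec_norm2 x"
  by (simp add: vec_norm2_eq_L2_set)

lemma vec_norm2_square: "(vec_norm2 x)\<^sup>2 = x \<bullet> x"
proof -
  have "0 \<le> x \<bullet> x"
    unfolding scalar_prod_def by (rule sum_nonneg) simp
  then show ?thesis by (simp add: vec_norm2_def)
qed

lemma abs_scalar_prod_le:
  assumes "dim_vec x = dim_vec y"
  shows "\<bar>x \<bullet> y\<bar> \<le> vec_norm2 x * vec_norm2 y"
proof -
  have "\<bar>x \<bullet> y\<bar> \<le> (\<Sum>i<dim_vec y. \<bar>x $ i\<bar> * \<bar>y $ i\<bar>)"
    unfolding scalar_prod_def lessThan_atLeast0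
    by (rule order_trans[OF sum_abs]) (simp add: abs_mult)
  also have "\<dots> \<le> vec_norm2 x * vec_norm2 y"
    unfolding vec_norm2_eq_L2_set assms by (rule L2_set_mult_ineq)
  finally show ?thesis .
qed

lemma abs_vec_index_le_norm2:
  assumes "k < dim_vec x"
  shows "\<bar>x $ k\<bar> \<le> vec_norm2 x"
proof -
  have "(x $ k)\<^sup>2 \<le> (\<Sum>i<dim_vec x. (x $ i)\<^sup>2)"
    using assms by (intro member_le_sum) auto
  then have "sqrt ((x $ k)\<^sup>2) \<le> vec_norm2 x"
    unfolding vec_norm2_eq_L2_set L2_set_def by (rule real_sqrt_le_mono)
  then show ?thesis by simp
qed

lemma vec_norm2_smult: "vec_norm2 (c \<cdot>\<^sub>v x) = \<bar>c\<bar> * vec_norm2 x"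
proof -
  have "(c \<cdot>\<^sub>v x) \<bullet> (c \<cdot>\<^sub>v x) = c\<^sup>2 * (x \<bullet> x)"
    unfolding scalar_prod_def by (simp add: sum_distrib_left power2_eq_square algebra_simps)
  then show ?thesis by (simp add: vec_norm2_def real_sqrt_mult)
qed

lemma vec_norm2_eq_0_iff: "vec_norm2 x = 0 \<longleftrightarrow> x = 0\<^sub>v (dim_vec x)"
proof
  assume "vec_norm2 x = 0"
  then have "\<bar>x $ k\<bar> \<le> 0" if "k < dim_vec x" for k
    using abs_vec_index_le_norm2[OF that] by simp
  then show "x = 0\<^sub>v (dim_vec x)" by auto
next
  assume "x = 0\<^sub>v (dim_vec x)"
  moreover have "vec_norm2 (0\<^sub>v n) = 0" for n
    by (simp add: vec_norm2_def)
  ultimately show "vec_norm2 x = 0" by metis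
qed

lemma unit_vec_in_unit_vecs: "k < m \<Longrightarrow> unit_vec m k \<in> unit_vecs m"
  by (simp add: unit_vecs_def vec_norm2_def)

lemma normalize_in_unit_vecs:
  assumes "x \<in> carrier_vec m" "vec_norm2 x \<noteq> 0"
  shows "(1 / vec_norm2 x) \<cdot>\<^sub>v x \<in> unit_vecs m"
  using assms by (simp add: unit_vecs_def vec_norm2_smult)

text \<open>Without a bound the supremum in \<open>mat_norm2\<close> would carry no information.
  Cauchy-Schwarz in every row gives the sum of the row norms as a crude bound.\<close>

lemma bdd_above_mat_norm2: "bdd_above ((\<lambda>x. vec_norm2 (B *\<^sub>v x)) ` unit_vecs (dim_col B))"
proof (rule bdd_aboveI2)
  fix x assume x: "x \<in> unit_vecs (dim_col B)"
  have "vec_norm2 (B *\<^sub>v x) \<le> (\<Sum>i<dim_row B. \<bar>(B *\<^sub>v x) $ i\<bar>)"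
    unfolding vec_norm2_eq_L2_set using L2_set_le_sum_abs[of "($) (B *\<^sub>v x)" "{..<dim_row B}"]
    by (simp del: index_mult_mat_vec)
  also have "\<dots> \<le> (\<Sum>i<dim_row B. vec_norm2 (row B i))"
  proof (rule sum_mono)
    fix i assume "i \<in> {..<dim_row B}"
    then show "\<bar>(B *\<^sub>v x) $ i\<bar> \<le> vec_norm2 (row B i)"
      using abs_scalar_prod_le[of "row B i" x] x by (auto simp: unit_vecs_def)
  qed
  finally show "vec_norm2 (B *\<^sub>v x) \<le> (\<Sum>i<dim_row B. vec_norm2 (row B i))" .
qed

lemma vec_norm2_mult_mat_vec_le:
  assumes B: "B \<in> carrier_mat m k" and x: "x \<in> unit_vecs k"
  shows "vec_norm2 (B *\<^sub>v x) \<le> mat_norm2 B"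
  unfolding mat_norm2_def using B x by (intro cSUP_upper bdd_above_mat_norm2) auto

text \<open>Moving one \<open>A\<close> across the scalar product leaves
  \<open>A\<^sup>T * A\<close>, the identity, in front of \<open>x\<close>.\<close>

lemma vec_norm2_orthonormal_cols:
  assumes A: "A \<in> carrier_mat m k" "orthonormal_cols A" and x: "x \<in> carrier_vec k"
  shows "vec_norm2 (A *\<^sub>v x) = vec_norm2 x"
proof -
  have "(A *\<^sub>v x) \<bullet> (A *\<^sub>v x) = x \<bullet> (A\<^sup>T *\<^sub>v (A *\<^sub>v x))"
    using transpose_vec_mult_scalar[OF A(1) x, of "A *\<^sub>v x"] A x by (simp add: comm_scalar_prod[of _ k])
  also have "A\<^sup>T *\<^sub>v (A *\<^sub>v x) = (A\<^sup>T * A) *\<^sub>v x"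
    using A x by (intro assoc_mult_mat_vec[symmetric]) auto
  also have "\<dots> = x"
    using A x by (simp add: orthonormal_cols_def)
  finally show ?thesis by (simp add: vec_norm2_def)
qed

text \<open>The adjoint of an isometry is a contraction: with \<open>y\<close> for the image of
  \<open>v\<close>, the square of the norm of \<open>y\<close> is the scalar product of
  \<open>v\<close> with \<open>A y\<close>, and \<open>A y\<close> is as long as \<open>y\<close>.
  Cauchy-Schwarz then lets one factor cancel.\<close>

lemma vec_norm2_transpose_orthonormal_cols:
  assumes A: "A \<in> carrier_mat m k" "orthonormal_cols A" and v: "v \<in> carrier_vec m"
  shows "vec_norm2 (A\<^sup>T *\<^sub>v v) \<le> vec_norm2 v"
proof -
  let ?y = "A\<^sup>T *\<^sub>v v"
  have y: "?y \<in> carrier_vec k" using A v by simp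
  have "(vec_norm2 ?y)\<^sup>2 = v \<bullet> (A *\<^sub>v ?y)"
    unfolding vec_norm2_square using transpose_vec_mult_scalar[OF A(1) y v] by simp
  also have "\<dots> \<le> vec_norm2 v * vec_norm2 ?y"
    using abs_scalar_prod_le[of v "A *\<^sub>v ?y"] vec_norm2_orthonormal_cols[OF A y] A v by simp
  finally have "vec_norm2 ?y * vec_norm2 ?y \<le> vec_norm2 v * vec_norm2 ?y"
    by (simp add: power2_eq_square)
  then show ?thesis
    by (cases "vec_norm2 ?y = 0") (auto simp: mult_le_cancel_right order.strict_iff_order)
qed

section \<open>Sums over multi-indices\<close>

lemma mem_multi_indices_iff:
  "i \<in> multi_indices d \<longleftrightarrow> length i = length d \<and> (\<forall>j<length d. i ! j < d ! j)"
  by (auto simp: multi_indices_def list_all2_conv_all_nth)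

lemma finite_multi_indices: "finite (multi_indices d)"
proof (rule finite_subset)
  show "multi_indices d \<subseteq> {i. set i \<subseteq> {..<sum_list d} \<and> length i = length d}"
    by (fastforce simp: mem_multi_indices_iff in_set_conv_nth
        intro: order.strict_trans2[OF _ elem_le_sum_list])
  show "finite {i. set i \<subseteq> {..<sum_list d} \<and> length i = length d}"
    by (rule finite_lists_length_eq) simp
qed

text \<open>Dimension 1 in mode \<open>n\<close> forces the entry 0 there, so
  \<open>multi_indices (d[n := 1])\<close> holds one representative of each fibre along mode
  \<open>n\<close>. The representatives do not depend on \<open>m\<close>, so the shapes before and
  after a mode product are summed over the same fibres.\<close>

lemma sum_multi_indices_update:
  assumes "n < length d"
  shows "sum f (multi_indices (d[n := m])) =
    (\<Sum>i\<in>multi_indices (d[n := 1]). \<Sum>k<m. f (i[n := k]))"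
proof -
  have "(\<Sum>i\<in>multi_indices (d[n := 1]). \<Sum>k<m. f (i[n := k])) =
      (\<Sum>(i, k)\<in>multi_indices (d[n := 1]) \<times> {..<m}. f (i[n := k]))"
    by (rule sum.cartesian_product)
  also have "\<dots> = sum f (multi_indices (d[n := m]))"
    by (rule sum.reindex_bij_witness[of _ "\<lambda>i. (i[n := 0], i ! n)" "\<lambda>(i, k). i[n := k]"])
      (use assms in \<open>auto simp: mem_multi_indices_iff nth_list_update list_eq_iff_nth_eq split: if_splits\<close>)
  finally show ?thesis by simp
qed

lemma sum_multi_indices_split:
  assumes "n < length d"
  shows "sum f (multi_indices d) =
    (\<Sum>i\<in>multi_indices (d[n := 1]). \<Sum>k<d ! n. f (i[n := k]))"
  using sum_multi_indices_update[OF assms, of f "d ! n"] by simp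

lemma prod_lessThan_remove:
  fixes f :: "nat \<Rightarrow> 'a :: comm_monoid_mult"
  assumes "n < N"
  shows "(\<Prod>j<N. f j) = f n * (\<Prod>j\<in>{..<N} - {n}. f j)"
  using assms by (intro prod.remove) auto

section \<open>Multilinear forms and their behaviour under mode products\<close>

lemma multilinear_form_cong:
  assumes "\<And>j. j < length d \<Longrightarrow> v j = w j"
  shows "multilinear_form d T v = multilinear_form d T w"
  unfolding multilinear_form_def using assms by simp

lemma multilinear_form_diff_tensor:
  "multilinear_form d (\<lambda>i. S i - T i) v = multilinear_form d S v - multilinear_form d T v"
  by (simp add: multilinear_form_def left_diff_distrib sum_subtractf)

lemma multilinear_form_add_tensor:
  "multilinear_form d (\<lambda>i. S i + T i) v = multilinear_form d S v + multilinear_form d T v"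
  by (simp add: multilinear_form_def distrib_right sum.distrib)

lemma multilinear_form_sum_tensor:
  "multilinear_form d (\<lambda>i. \<Sum>a\<in>I. T a i) v = (\<Sum>a\<in>I. multilinear_form d (T a) v)"
  unfolding multilinear_form_def by (simp add: sum_distrib_right sum.swap[of _ I])

lemma multilinear_form_split:
  assumes n: "n < length d"
  shows "multilinear_form d T v =
    (\<Sum>i\<in>multi_indices d. T i * (v n $ (i ! n) * (\<Prod>j\<in>{..<length d} - {n}. v j $ (i ! j))))"
  unfolding multilinear_form_def using n by (simp add: prod_lessThan_remove)

lemma multilinear_form_add:
  assumes n: "n < length d" and x: "x \<in> carrier_vec (d ! n)" and y: "y \<in> carrier_vec (d ! n)"
  shows "multilinear_form d T (v(n := x + y)) =
    multilinear_form d T (v(n := x)) + multilinear_form d T (v(n := y))"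
  unfolding multilinear_form_split[OF n] sum.distrib[symmetric]
proof (rule sum.cong[OF refl])
  fix i assume "i \<in> multi_indices d"
  \<comment> \<open>Vector addition is entrywise only at positions within the dimension.\<close>
  then have "i ! n < d ! n" using n by (simp add: mem_multi_indices_iff)
  then have "(x + y) $ (i ! n) = x $ (i ! n) + y $ (i ! n)" using x y by simp
  then show "T i * ((v(n := x + y)) n $ (i ! n) * (\<Prod>j\<in>{..<length d} - {n}. (v(n := x + y)) j $ (i ! j))) =
     T i * ((v(n := x)) n $ (i ! n) * (\<Prod>j\<in>{..<length d} - {n}. (v(n := x)) j $ (i ! j))) +
     T i * ((v(n := y)) n $ (i ! n) * (\<Prod>j\<in>{..<length d} - {n}. (v(n := y)) j $ (i ! j)))"
    by (simp add: algebra_simps)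
qed

text \<open>On each fibre, the sums over the new index \<open>l\<close> and the old index
  \<open>k\<close> are exchanged; the inner sum over \<open>l\<close> is then entry \<open>k\<close>
  of \<open>B\<^sup>T\<close> applied to \<open>v n\<close>. The matrix thus passes from the tensor
  to the argument.\<close>

lemma multilinear_form_mode_prod:
  assumes n: "n < length d" and B: "B \<in> carrier_mat m (d ! n)" and v: "v n \<in> carrier_vec m"
  shows "multilinear_form (d[n := m]) (mode_prod T n B) v =
    multilinear_form d T (v(n := B\<^sup>T *\<^sub>v v n))"
proof -
  let ?N = "length d"
  let ?I = "multi_indices (d[n := 1])"
  let ?P = "\<lambda>i. \<Prod>j\<in>{..<?N} - {n}. v j $ (i ! j)"
  have P: "?P (i[n := k]) = ?P i" for i k
    by (rule prod.cong) auto
  have len: "length i = ?N" if "i \<in> ?I" for i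
    using that by (simp add: mem_multi_indices_iff)
  have "multilinear_form (d[n := m]) (mode_prod T n B) v =
      (\<Sum>i\<in>multi_indices (d[n := m]). mode_prod T n B i * (v n $ (i ! n) * ?P i))"
    using n by (simp add: multilinear_form_split[of n])
  also have "\<dots> = (\<Sum>i\<in>?I. \<Sum>l<m. mode_prod T n B (i[n := l]) * (v n $ (i[n := l] ! n) * ?P i))"
    by (subst sum_multi_indices_update[OF n]) (simp only: P)
  also have "\<dots> = (\<Sum>i\<in>?I. \<Sum>l<m. \<Sum>k<d ! n. T (i[n := k]) * (B $$ (l, k) * v n $ l) * ?P i)"
    using n B len by (simp add: mode_prod_def sum_distrib_right mult.assoc)
  also have "\<dots> = (\<Sum>i\<in>?I. \<Sum>k<d ! n. \<Sum>l<m. T (i[n := k]) * (B $$ (l, k) * v n $ l) * ?P i)"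
    by (intro sum.cong[OF refl] sum.swap)
  also have "\<dots> = (\<Sum>i\<in>?I. \<Sum>k<d ! n. T (i[n := k]) * ((B\<^sup>T *\<^sub>v v n) $ k * ?P i))"
    using B v by (simp add: scalar_prod_def lessThan_atLeast0 sum_distrib_left sum_distrib_right mult.assoc)
  also have "\<dots> = (\<Sum>i\<in>?I. \<Sum>k<d ! n. T (i[n := k]) * ((B\<^sup>T *\<^sub>v v n) $ (i[n := k] ! n) * ?P (i[n := k])))"
    unfolding P using n len by simp
  also have "\<dots> = (\<Sum>i\<in>multi_indices d. T i * ((B\<^sup>T *\<^sub>v v n) $ (i ! n) * ?P i))"
    by (rule sum_multi_indices_split[OF n, symmetric])
  also have "\<dots> = multilinear_form d T (v(n := B\<^sup>T *\<^sub>v v n))"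
    using n by (simp add: multilinear_form_split[of n])
  finally show ?thesis .
qed

text \<open>Since the modes are distinct, each product acts on an argument that the others leave
  alone. The final shape \<open>e\<close> stays fixed in the induction, while \<open>d\<close>
  varies because the first product changes it to \<open>d[n := e ! n]\<close>.\<close>

lemma multilinear_form_mode_prods:
  assumes "distinct ms" "set ms \<subseteq> {..<length d}" "length e = length d"
    and "\<And>j. j \<in> set ms \<Longrightarrow> B j \<in> carrier_mat (e ! j) (d ! j)"
    and "\<And>j. j < length d \<Longrightarrow> j \<notin> set ms \<Longrightarrow> e ! j = d ! j"
    and "\<And>j. j \<in> set ms \<Longrightarrow> v j \<in> carrier_vec (e ! j)"
  shows "multilinear_form e (mode_prods T ms B) v =
    multilinear_form d T (\<lambda>j. if j \<in> set ms then (B j)\<^sup>T *\<^sub>v v j else v j)"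
  using assms
proof (induction ms arbitrary: T d)
  case Nil
  then have "e = d" by (simp add: list_eq_iff_nth_eq)
  then show ?case by (simp add: mode_prods_def)
next
  case (Cons n ms)
  let ?w = "\<lambda>j. if j \<in> set ms then (B j)\<^sup>T *\<^sub>v v j else v j"
  have n: "n < length d" "n \<notin> set ms" using Cons.prems by auto
  have "multilinear_form e (mode_prods T (n # ms) B) v =
      multilinear_form e (mode_prods (mode_prod T n (B n)) ms B) v"
    by (simp add: mode_prods_def)
  also have "\<dots> = multilinear_form (d[n := e ! n]) (mode_prod T n (B n)) ?w"
  proof (rule Cons.IH)
    show "B j \<in> carrier_mat (e ! j) (d[n := e ! n] ! j)" if "j \<in> set ms" for j
      using that n Cons.prems(4)[of j] by (auto simp: nth_list_update)
    show "e ! j = d[n := e ! n] ! j" if "j < length (d[n := e ! n])" "j \<notin> set ms" for j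
      using that Cons.prems(5)[of j] by (cases "j = n") auto
  qed (use Cons.prems in auto)
  also have "\<dots> = multilinear_form d T (?w(n := (B n)\<^sup>T *\<^sub>v ?w n))"
    using n Cons.prems by (intro multilinear_form_mode_prod) auto
  also have "?w(n := (B n)\<^sup>T *\<^sub>v ?w n) =
      (\<lambda>j. if j \<in> set (n # ms) then (B j)\<^sup>T *\<^sub>v v j else v j)"
    using n by auto
  finally show ?case .
qed

section \<open>The spectral norm as a supremum of the multilinear form\<close>

lemma multi_indices_replicate_1:
  "multi_indices (m # replicate l 1) = (\<lambda>k. k # replicate l 0) ` {..<m}"
proof -
  have "i \<in> multi_indices (replicate l 1) \<longleftrightarrow> i = replicate l 0" for i
    by (auto simp: mem_multi_indices_iff list_eq_iff_nth_eq)
  then show ?thesis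
    by (fastforce simp: multi_indices_def list_all2_Cons2)
qed

text \<open>The link between \<open>tensor_norm2\<close> and the form: pairing the remaining open
  mode with \<open>y\<close> closes it, and the contracted vectors become the other
  arguments.\<close>

lemma contract_all_but_first_scalar_prod:
  assumes d: "d \<noteq> []" and x: "\<And>j. 1 \<le> j \<Longrightarrow> j < length d \<Longrightarrow> x j \<in> carrier_vec (d ! j)"
    and y: "y \<in> carrier_vec (d ! 0)"
  shows "contract_all_but_first d T x \<bullet> y = multilinear_form d T (x(0 := y))"
proof -
  define B where "B j = mat_of_rows (d ! j) [x j]" for j
  define M where "M = mode_prods T [1..<length d] B"
  define e where "e = d ! 0 # replicate (length d - 1) 1"
  \<comment> \<open>Contracted modes survive with dimension 1. The argument with single entry 1
    leaves the value unchanged there, and the transposed row matrix sends it to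
    \<open>x j\<close>.\<close>
  define v where "v j = (if j = 0 then y else vec 1 (\<lambda>_. 1))" for j :: nat
  have len: "length e = length d" using d by (simp add: e_def)
  have B_one: "(B j)\<^sup>T *\<^sub>v vec 1 (\<lambda>_. 1) = x j" if "1 \<le> j" "j < length d" for j
    using x[OF that] by (intro eq_vecI) (auto simp: B_def scalar_prod_def mat_of_rows_def)
  have "multilinear_form e M v =
      (\<Sum>k<d ! 0. M (k # replicate (length d - 1) 0) *
        (\<Prod>j<length e. v j $ ((k # replicate (length d - 1) 0) ! j)))"
    unfolding multilinear_form_def e_def multi_indices_replicate_1
    by (subst sum.reindex) (auto simp: inj_on_def)
  also have "\<dots> = (\<Sum>k<d ! 0. M (k # replicate (length d - 1) 0) * y $ k)"
  proof (rule sum.cong[OF refl])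
    fix k
    have "(\<Prod>j<length e. v j $ ((k # replicate (length d - 1) 0) ! j)) =
        y $ k * (\<Prod>j\<in>{..<length e} - {0}. v j $ ((k # replicate (length d - 1) 0) ! j))"
      using d by (subst prod_lessThan_remove[of 0]) (auto simp: v_def len)
    also have "(\<Prod>j\<in>{..<length e} - {0}. v j $ ((k # replicate (length d - 1) 0) ! j)) = 1"
    proof (rule prod.neutral, rule ballI)
      fix j assume "j \<in> {..<length e} - {0}"
      then show "v j $ ((k # replicate (length d - 1) 0) ! j) = 1"
        by (cases j) (auto simp: v_def len)
    qed
    finally show "M (k # replicate (length d - 1) 0) *
        (\<Prod>j<length e. v j $ ((k # replicate (length d - 1) 0) ! j)) =
        M (k # replicate (length d - 1) 0) * y $ k" by simp
  qed
  also have "\<dots> = contract_all_but_first d T x \<bullet> y"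
    using y by (simp add: contract_all_but_first_def scalar_prod_def M_def B_def[abs_def] lessThan_atLeast0)
  finally have "contract_all_but_first d T x \<bullet> y = multilinear_form e M v" ..
  also have "\<dots> = multilinear_form d T (\<lambda>j. if j \<in> set [1..<length d] then (B j)\<^sup>T *\<^sub>v v j else v j)"
    unfolding M_def
    by (rule multilinear_form_mode_prods)
      (use d len in \<open>auto simp: B_def v_def e_def nth_Cons' mat_of_rows_def Suc_le_eq\<close>)
  also have "\<dots> = multilinear_form d T (x(0 := y))"
  proof (rule multilinear_form_cong)
    fix j assume "j < length d"
    then show "(if j \<in> set [1..<length d] then (B j)\<^sup>T *\<^sub>v v j else v j) = (x(0 := y)) j"
      using B_one[of j] by (cases "j = 0") (auto simp: v_def)
  qed
  finally show ?thesis .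
qed

text \<open>Every coordinate is at most the norm of its vector. The constant is crude and serves
  only to show that the supremum in \<open>tensor_norm2\<close> is bounded.\<close>

lemma abs_multilinear_form_le_sum:
  assumes "\<And>j. j < length d \<Longrightarrow> v j \<in> carrier_vec (d ! j)"
  shows "\<bar>multilinear_form d T v\<bar> \<le>
    (\<Sum>i\<in>multi_indices d. \<bar>T i\<bar>) * (\<Prod>j<length d. vec_norm2 (v j))"
  unfolding multilinear_form_def sum_distrib_right
proof (rule order_trans[OF sum_abs], rule sum_mono)
  fix i assume "i \<in> multi_indices d"
  then have "(\<Prod>j<length d. \<bar>v j $ (i ! j)\<bar>) \<le> (\<Prod>j<length d. vec_norm2 (v j))"
    using carrier_vecD[OF assms]
    by (intro prod_mono) (auto simp: mem_multi_indices_iff intro!: abs_vec_index_le_norm2)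
  then show "\<bar>T i * (\<Prod>j<length d. v j $ (i ! j))\<bar> \<le> \<bar>T i\<bar> * (\<Prod>j<length d. vec_norm2 (v j))"
    by (simp add: abs_mult abs_prod mult_left_mono)
qed

lemma contract_all_but_first_carrier:
  "contract_all_but_first d T x \<in> carrier_vec (d ! 0)"
  by (simp add: contract_all_but_first_def)

lemma bdd_above_tensor_norm2:
  assumes d: "d \<noteq> []"
  shows "bdd_above ((\<lambda>x. vec_norm2 (contract_all_but_first d T x)) `
    {x. \<forall>j\<in>{1..<length d}. x j \<in> unit_vecs (d ! j)})"
proof (rule bdd_aboveI2)
  fix x assume "x \<in> {x. \<forall>j\<in>{1..<length d}. x j \<in> unit_vecs (d ! j)}"
  then have x: "x j \<in> carrier_vec (d ! j)" "vec_norm2 (x j) = 1" if "1 \<le> j" "j < length d" for j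
    using that by (auto simp: unit_vecs_def)
  let ?c = "contract_all_but_first d T x" and ?S = "\<Sum>i\<in>multi_indices d. \<bar>T i\<bar>"
  \<comment> \<open>The contraction is paired with itself: its square is a value of the form, hence
    at most \<open>?S\<close> times its norm, and one factor cancels.\<close>
  have "(vec_norm2 ?c)\<^sup>2 = multilinear_form d T (x(0 := ?c))"
    unfolding vec_norm2_square using d x
    by (intro contract_all_but_first_scalar_prod) (auto simp: contract_all_but_first_carrier)
  also have "\<dots> \<le> ?S * (\<Prod>j<length d. vec_norm2 ((x(0 := ?c)) j))"
    using x by (intro order_trans[OF abs_ge_self abs_multilinear_form_le_sum])
      (auto simp: contract_all_but_first_carrier)
  also have "(\<Prod>j<length d. vec_norm2 ((x(0 := ?c)) j)) =
      vec_norm2 ?c * (\<Prod>j\<in>{..<length d} - {0}. vec_norm2 ((x(0 := ?c)) j))"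
    using d by (subst prod_lessThan_remove[of 0]) auto
  also have "(\<Prod>j\<in>{..<length d} - {0}. vec_norm2 ((x(0 := ?c)) j)) = 1"
    using x by (intro prod.neutral) auto
  finally have "vec_norm2 ?c * vec_norm2 ?c \<le> ?S * vec_norm2 ?c"
    by (simp add: power2_eq_square)
  moreover have "0 \<le> ?S" by (rule sum_nonneg) simp
  ultimately show "vec_norm2 ?c \<le> ?S"
    by (cases "vec_norm2 ?c = 0") (auto simp: mult_le_cancel_right order.strict_iff_order)
qed

text \<open>One half of the supremum characterization: Cauchy-Schwarz in mode 0 against a unit
  vector.\<close>

lemma abs_multilinear_form_unit_le:
  assumes d: "d \<noteq> []" and v: "\<And>j. j < length d \<Longrightarrow> v j \<in> unit_vecs (d ! j)"
  shows "\<bar>multilinear_form d T v\<bar> \<le> tensor_norm2 d T"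
proof -
  have v': "v j \<in> carrier_vec (d ! j)" "vec_norm2 (v j) = 1" if "j < length d" for j
    using v[OF that] by (auto simp: unit_vecs_def)
  have 0: "0 < length d" using d by simp
  have "multilinear_form d T v = contract_all_but_first d T v \<bullet> v 0"
    using contract_all_but_first_scalar_prod[OF d, of v "v 0" T] v' 0 by simp
  then have "\<bar>multilinear_form d T v\<bar> \<le> vec_norm2 (contract_all_but_first d T v)"
    using abs_scalar_prod_le[of "contract_all_but_first d T v" "v 0"] v'[OF 0]
    by (simp add: contract_all_but_first_def)
  also have "\<dots> \<le> tensor_norm2 d T"
    unfolding tensor_norm2_def using v by (intro cSUP_upper bdd_above_tensor_norm2 d) auto
  finally show ?thesis .
qed

lemma multilinear_form_zero_vec:
  assumes "n < length d" "v n = 0\<^sub>v (d ! n)"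
  shows "multilinear_form d T v = 0"
  unfolding multilinear_form_split[OF assms(1)]
  by (rule sum.neutral) (use assms in \<open>auto simp: mem_multi_indices_iff\<close>)

lemma multilinear_form_smult_all:
  assumes v: "\<And>j. j < length d \<Longrightarrow> v j \<in> carrier_vec (d ! j)"
  shows "multilinear_form d T (\<lambda>j. c j \<cdot>\<^sub>v v j) = (\<Prod>j<length d. c j) * multilinear_form d T v"
  unfolding multilinear_form_def sum_distrib_left
proof (rule sum.cong[OF refl])
  fix i assume "i \<in> multi_indices d"
  then have "(\<Prod>j<length d. (c j \<cdot>\<^sub>v v j) $ (i ! j)) = (\<Prod>j<length d. c j * v j $ (i ! j))"
    using carrier_vecD[OF v] by (intro prod.cong) (auto simp: mem_multi_indices_iff)
  then show "T i * (\<Prod>j<length d. (c j \<cdot>\<^sub>v v j) $ (i ! j)) =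
      (\<Prod>j<length d. c j) * (T i * (\<Prod>j<length d. v j $ (i ! j)))"
    by (simp add: prod.distrib)
qed

text \<open>By homogeneity all arguments can be normalized, unless one of them is zero; then both
  sides vanish.\<close>

lemma abs_multilinear_form_le:
  assumes d: "d \<noteq> []" and v: "\<And>j. j < length d \<Longrightarrow> v j \<in> carrier_vec (d ! j)"
  shows "\<bar>multilinear_form d T v\<bar> \<le> tensor_norm2 d T * (\<Prod>j<length d. vec_norm2 (v j))"
proof (cases "\<exists>j<length d. vec_norm2 (v j) = 0")
  case True
  then obtain j where j: "j < length d" "vec_norm2 (v j) = 0" by blast
  then have "v j = 0\<^sub>v (d ! j)"
    using v[OF j(1)] by (simp add: vec_norm2_eq_0_iff)
  then have "multilinear_form d T v = 0"
    using j by (intro multilinear_form_zero_vec)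
  moreover have "(\<Prod>j<length d. vec_norm2 (v j)) = 0"
    using j by (intro prod_zero) auto
  ultimately show ?thesis by (simp del: prod_zero_iff)
next
  case False
  let ?p = "\<Prod>j<length d. vec_norm2 (v j)"
  have p: "0 < ?p" using False by (intro prod_pos) (auto simp: order.strict_iff_order)
  have "\<bar>multilinear_form d T (\<lambda>j. (1 / vec_norm2 (v j)) \<cdot>\<^sub>v v j)\<bar> \<le> tensor_norm2 d T"
    using False v by (intro abs_multilinear_form_unit_le d normalize_in_unit_vecs) auto
  then have "\<bar>multilinear_form d T v\<bar> / ?p \<le> tensor_norm2 d T"
    using p by (simp add: multilinear_form_smult_all[OF v] prod_dividef abs_mult)
  then show ?thesis using p by (simp add: pos_divide_le_eq)
qed

text \<open>The other half of the characterization: the norm of a nonzero contraction is the value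
  of the form with the normalized contraction in mode 0. Positive dimensions ensure that unit
  vectors exist.\<close>

lemma tensor_norm2_le:
  assumes d: "d \<noteq> []" "\<And>j. j < length d \<Longrightarrow> 0 < d ! j"
    and M: "\<And>v. (\<And>j. j < length d \<Longrightarrow> v j \<in> unit_vecs (d ! j)) \<Longrightarrow> \<bar>multilinear_form d T v\<bar> \<le> M"
  shows "tensor_norm2 d T \<le> M"
  unfolding tensor_norm2_def
proof (rule cSUP_least)
  have e: "unit_vec (d ! j) 0 \<in> unit_vecs (d ! j)" if "j < length d" for j
    using d(2)[OF that] by (rule unit_vec_in_unit_vecs)
  then show "{x. \<forall>j\<in>{1..<length d}. x j \<in> unit_vecs (d ! j)} \<noteq> {}"
    by (intro ex_in_conv[THEN iffD1] exI[of _ "\<lambda>j. unit_vec (d ! j) 0"]) simp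
  \<comment> \<open>A zero contraction cannot be normalized; for it the bound is just
    \<open>0 \<le> M\<close>.\<close>
  have "0 \<le> \<bar>multilinear_form d T (\<lambda>j. unit_vec (d ! j) 0)\<bar>" by simp
  also have "\<dots> \<le> M" using e by (rule M)
  finally have M0: "0 \<le> M" .
  fix x assume "x \<in> {x. \<forall>j\<in>{1..<length d}. x j \<in> unit_vecs (d ! j)}"
  then have x: "x j \<in> unit_vecs (d ! j)" if "1 \<le> j" "j < length d" for j
    using that by auto
  let ?c = "contract_all_but_first d T x"
  show "vec_norm2 ?c \<le> M"
  proof (cases "vec_norm2 ?c = 0")
    case False
    let ?u = "(1 / vec_norm2 ?c) \<cdot>\<^sub>v ?c"
    have u: "?u \<in> unit_vecs (d ! 0)"
      using False by (intro normalize_in_unit_vecs contract_all_but_first_carrier)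
    have "?c \<bullet> ?u = vec_norm2 ?c"
      using False by (simp add: vec_norm2_square[symmetric] power2_eq_square)
    then have "vec_norm2 ?c = multilinear_form d T (x(0 := ?u))"
      using contract_all_but_first_scalar_prod[OF d(1), of x ?u T] x u
      by (simp add: unit_vecs_def)
    also have "\<dots> \<le> \<bar>multilinear_form d T (x(0 := ?u))\<bar>" by simp
    also have "\<dots> \<le> M"
      using x u by (intro M) auto
    finally show ?thesis .
  qed (use M0 in simp)
qed

lemma tensor_norm2_nonneg:
  assumes "d \<noteq> []" "\<And>j. j < length d \<Longrightarrow> 0 < d ! j"
  shows "0 \<le> tensor_norm2 d T"
proof -
  have "0 \<le> \<bar>multilinear_form d T (\<lambda>j. unit_vec (d ! j) 0)\<bar>" by simp
  also have "\<dots> \<le> tensor_norm2 d T"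
    using assms by (intro abs_multilinear_form_unit_le unit_vec_in_unit_vecs)
  finally show ?thesis .
qed

text \<open>Transposed factors and projections may shorten unit vectors, so the bound is also wanted
  on the unit ball.\<close>

lemma abs_multilinear_form_le_norm2:
  assumes d: "\<And>j. j < length d \<Longrightarrow> 0 < d ! j" "d \<noteq> []"
    and v: "\<And>j. j < length d \<Longrightarrow> v j \<in> carrier_vec (d ! j)"
      "\<And>j. j < length d \<Longrightarrow> vec_norm2 (v j) \<le> 1"
  shows "\<bar>multilinear_form d T v\<bar> \<le> tensor_norm2 d T"
proof -
  have "tensor_norm2 d T * (\<Prod>j<length d. vec_norm2 (v j)) \<le> tensor_norm2 d T * 1"
    using v d by (intro mult_left_mono prod_le_1 tensor_norm2_nonneg) auto
  with abs_multilinear_form_le[where T = T, OF d(2) v(1)] show ?thesis by simp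
qed

text \<open>Standard basis vectors read off a single entry; this makes the norm of a nonzero tensor
  positive.\<close>

lemma multilinear_form_unit_vecs:
  assumes i: "i \<in> multi_indices d"
  shows "multilinear_form d T (\<lambda>j. unit_vec (d ! j) (i ! j)) = T i"
proof -
  have "(\<Prod>j<length d. unit_vec (d ! j) (i ! j) $ (l ! j)) = (if l = i then 1 else 0 :: real)"
    if l: "l \<in> multi_indices d" for l
  proof (cases "l = i")
    case True
    then show ?thesis using i by (auto simp: mem_multi_indices_iff intro!: prod.neutral)
  next
    case False
    then obtain j where "j < length d" "l ! j \<noteq> i ! j"
      using i l nth_equalityI[of l i] unfolding mem_multi_indices_iff by metis
    then have "unit_vec (d ! j) (i ! j) $ (l ! j) = (0 :: real)"
      using i l by (auto simp: mem_multi_indices_iff)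
    with \<open>j < length d\<close> False show ?thesis
      by (auto intro!: prod_zero)
  qed
  then have "multilinear_form d T (\<lambda>j. unit_vec (d ! j) (i ! j)) =
      (\<Sum>l\<in>multi_indices d. T l * (if l = i then 1 else 0))"
    unfolding multilinear_form_def by (intro sum.cong) auto
  also have "\<dots> = T i"
    using i by (simp add: finite_multi_indices if_distrib[of "(*) _"] cong: if_cong)
  finally show ?thesis .
qed

lemma tensor_norm2_pos:
  assumes d: "d \<noteq> []" and i: "i \<in> multi_indices d" "T i \<noteq> 0"
  shows "0 < tensor_norm2 d T"
proof -
  have "0 < \<bar>multilinear_form d T (\<lambda>j. unit_vec (d ! j) (i ! j))\<bar>"
    using i by (simp add: multilinear_form_unit_vecs)
  also have "\<dots> \<le> tensor_norm2 d T"
    using i by (intro abs_multilinear_form_unit_le d unit_vec_in_unit_vecs)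
      (auto simp: mem_multi_indices_iff)
  finally show ?thesis .
qed

section \<open>The remainder of the first-order expansion\<close>

lemma abs_multilinear_form_two_small_le:
  assumes d: "d \<noteq> []" and v: "\<And>j. j < length d \<Longrightarrow> v j \<in> carrier_vec (d ! j)"
    and le1: "\<And>j. j < length d \<Longrightarrow> j \<noteq> m \<Longrightarrow> j \<noteq> k \<Longrightarrow> vec_norm2 (v j) \<le> 1"
    and mk: "m < length d" "k < length d" "m \<noteq> k" "vec_norm2 (v m) \<le> \<epsilon>" "vec_norm2 (v k) \<le> \<epsilon>"
    and pos: "0 \<le> tensor_norm2 d T"
  shows "\<bar>multilinear_form d T v\<bar> \<le> tensor_norm2 d T * \<epsilon>\<^sup>2"
proof -
  let ?q = "\<Prod>j\<in>{..<length d} - {m} - {k}. vec_norm2 (v j)"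
  \<comment> \<open>As a bound on a norm, \<epsilon> is nonnegative, which the monotonicity of
    products below requires.\<close>
  have \<epsilon>: "0 \<le> \<epsilon>" using mk(4) vec_norm2_nonneg by (rule order_trans[rotated])
  have "(\<Prod>j<length d. vec_norm2 (v j)) = vec_norm2 (v m) * (vec_norm2 (v k) * ?q)"
    unfolding prod_lessThan_remove[OF mk(1)] using mk by (subst prod.remove[of _ k]) auto
  also have "\<dots> \<le> \<epsilon> * (\<epsilon> * 1)"
    using mk \<epsilon> le1 by (intro mult_mono prod_le_1 mult_nonneg_nonneg prod_nonneg) auto
  finally have "(\<Prod>j<length d. vec_norm2 (v j)) \<le> \<epsilon>\<^sup>2" by (simp add: power2_eq_square)
  then have "tensor_norm2 d T * (\<Prod>j<length d. vec_norm2 (v j)) \<le> tensor_norm2 d T * \<epsilon>\<^sup>2"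
    using pos by (rule mult_left_mono)
  with abs_multilinear_form_le[where T = T, OF d v] show ?thesis
    by (rule order_trans)
qed

text \<open>The modes of \<open>J\<close> are perturbed one at a time. The \<open>k\<close>-th
  remainder grows by at most \<open>k\<close> terms with two small arguments, and these increments
  add up to less than the square of the number of modes. As both \<open>a j\<close> and
  \<open>a j + b j\<close> lie in the unit ball, the other arguments contribute factors of at most
  1.\<close>

lemma multilinear_form_first_order_error:
  fixes a b :: "nat \<Rightarrow> real vec" and T :: tensor
  defines "c \<equiv> \<lambda>J j. if j \<in> J then a j + b j else a j"
  assumes d: "d \<noteq> []" and pos: "0 \<le> tensor_norm2 d T"
    and a: "\<And>j. j < length d \<Longrightarrow> a j \<in> carrier_vec (d ! j)"
      "\<And>j. j < length d \<Longrightarrow> vec_norm2 (a j) \<le> 1"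
    and "finite J" "J \<subseteq> {..<length d}"
    and "\<And>j. j \<in> J \<Longrightarrow> b j \<in> carrier_vec (d ! j)"
    and "\<And>j. j \<in> J \<Longrightarrow> vec_norm2 (a j + b j) \<le> 1"
    and "\<And>j. j \<in> J \<Longrightarrow> vec_norm2 (b j) \<le> \<epsilon>"
  shows "\<bar>multilinear_form d T (c J) - multilinear_form d T a
          - (\<Sum>i\<in>J. multilinear_form d T (a(i := b i)))\<bar>
        \<le> (real (card J))\<^sup>2 * (tensor_norm2 d T * \<epsilon>\<^sup>2)"
proof -
  let ?F = "multilinear_form d T" and ?K = "tensor_norm2 d T * \<epsilon>\<^sup>2"
  have upd: "c (insert k J) = (c J)(k := a k + b k)" for k J
    by (auto simp: c_def)
  have c0: "(c J)(k := a k) = c J" if "k \<notin> J" for k J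
    using that by (auto simp: c_def)
  txt \<open>Adding one mode \<open>m\<close> to \<open>J\<close> changes the remainder by the difference below, which telescopes into
    terms with two perturbed modes.\<close>
  have small: "\<bar>?F ((c J)(m := y)) - ?F (a(m := y))\<bar> \<le> real (card J) * ?K"
    if "finite J" "J \<subseteq> {..<length d}"
      "\<And>j. j \<in> J \<Longrightarrow> b j \<in> carrier_vec (d ! j)"
      "\<And>j. j \<in> J \<Longrightarrow> vec_norm2 (a j + b j) \<le> 1"
      "\<And>j. j \<in> J \<Longrightarrow> vec_norm2 (b j) \<le> \<epsilon>"
      "m < length d" "m \<notin> J" "y \<in> carrier_vec (d ! m)" "vec_norm2 y \<le> \<epsilon>" for J m y
    using that
  proof (induction J rule: finite_induct)
    case empty
    then show ?case by (simp add: c_def)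
  next
    case (insert k J)
    let ?v = "(c J)(m := y)"
    have IH: "\<bar>?F ?v - ?F (a(m := y))\<bar> \<le> real (card J) * ?K"
      using insert.prems by (intro insert.IH) auto
    have k: "k < length d" "k \<noteq> m" using insert.prems by auto
    have "?F ((c (insert k J))(m := y)) = ?F (?v(k := a k + b k))"
      unfolding upd using k by (simp add: fun_upd_twist)
    also have "\<dots> = ?F (?v(k := a k)) + ?F (?v(k := b k))"
      using k a insert.prems by (intro multilinear_form_add) auto
    also have "?v(k := a k) = ?v"
      using k insert.hyps c0[of k J] by (metis fun_upd_twist)
    finally have "?F ((c (insert k J))(m := y)) = ?F ?v + ?F (?v(k := b k))" .
    \<comment> \<open>Modes \<open>m\<close> and \<open>k\<close> hold \<open>y\<close> and
      \<open>b k\<close>, both of norm at most \<epsilon>.\<close>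
    moreover have "\<bar>?F (?v(k := b k))\<bar> \<le> ?K"
    proof (rule abs_multilinear_form_two_small_le[OF d, of _ m k])
      show "(?v(k := b k)) j \<in> carrier_vec (d ! j)" if "j < length d" for j
        using that k a insert.prems by (auto simp: c_def)
      show "vec_norm2 ((?v(k := b k)) j) \<le> 1" if "j < length d" "j \<noteq> m" "j \<noteq> k" for j
        using that a insert.prems by (auto simp: c_def)
    qed (use k insert.prems pos in auto)
    moreover have "real (card (insert k J)) * ?K = real (card J) * ?K + ?K"
      using insert.hyps by (simp add: distrib_right)
    ultimately show ?case using IH by linarith
  qed
  show "\<bar>?F (c J) - ?F a - (\<Sum>i\<in>J. ?F (a(i := b i)))\<bar> \<le> (real (card J))\<^sup>2 * ?K"
    using assms(6-)
  proof (induction J rule: finite_induct)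
    case empty
    then show ?case by (simp add: c_def)
  next
    case (insert m J)
    have IH: "\<bar>?F (c J) - ?F a - (\<Sum>i\<in>J. ?F (a(i := b i)))\<bar> \<le> (real (card J))\<^sup>2 * ?K"
      using insert.prems by (intro insert.IH) auto
    have m: "m < length d" using insert.prems by auto
    have "?F (c (insert m J)) = ?F ((c J)(m := a m)) + ?F ((c J)(m := b m))"
      unfolding upd using m a insert.prems by (intro multilinear_form_add) auto
    then have "?F (c (insert m J)) - ?F a - (\<Sum>i\<in>insert m J. ?F (a(i := b i))) =
        (?F (c J) - ?F a - (\<Sum>i\<in>J. ?F (a(i := b i))))
        + (?F ((c J)(m := b m)) - ?F (a(m := b m)))"
      using insert.hyps by (simp add: c0)
    moreover have "\<bar>?F ((c J)(m := b m)) - ?F (a(m := b m))\<bar> \<le> real (card J) * ?K"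
      using insert.hyps insert.prems m by (intro small) auto
    moreover have "0 \<le> real (card J) * ?K" "0 \<le> ?K" using pos by auto
    \<comment> \<open>The increment is \<open>card J\<close> times \<open>?K\<close>; the square
      grows by \<open>2 * card J + 1\<close>, which leaves room for it.\<close>
    moreover have "(real (card (insert m J)))\<^sup>2 * ?K =
        (real (card J))\<^sup>2 * ?K + 2 * (real (card J) * ?K) + ?K"
      using insert.hyps by (simp add: power2_eq_square algebra_simps)
    ultimately show ?case using IH by linarith
  qed
qed

section \<open>Bounds for the denominator and the numerator of the relative error\<close>

lemma multilinear_form_ttm_except:
  assumes "length s = N" "length e = N"
    and "\<And>j. j < N \<Longrightarrow> j \<notin> S \<Longrightarrow> B j \<in> carrier_mat (s ! j) (e ! j)"
    and "\<And>j. j < N \<Longrightarrow> j \<in> S \<Longrightarrow> e ! j = s ! j"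
    and "\<And>j. j < N \<Longrightarrow> j \<notin> S \<Longrightarrow> v j \<in> carrier_vec (e ! j)"
  shows "multilinear_form e (ttm_except N S X B) v =
    multilinear_form s X (\<lambda>j. if j \<in> S then v j else B j *\<^sub>v v j)"
proof -
  have "multilinear_form e (ttm_except N S X B) v =
      multilinear_form s X (\<lambda>j. if j \<in> set (filter (\<lambda>j. j \<notin> S) [0..<N])
        then (B j)\<^sup>T\<^sup>T *\<^sub>v v j else v j)"
    unfolding ttm_except_def using assms by (intro multilinear_form_mode_prods) auto
  also have "\<dots> = multilinear_form s X (\<lambda>j. if j \<in> S then v j else B j *\<^sub>v v j)"
    using assms by (intro multilinear_form_cong) auto
  finally show ?thesis .
qed

text \<open>The residual enters twice, at \<open>v\<close> and at its projection \<open>w\<close>,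
  and costs at most 2/3 of the norm of \<open>X\<close>. The remaining third is bounded by the norm
  of \<open>Y\<close>, whence the factor 3.\<close>

lemma tensor_norm2_le_ttm_except:
  assumes len: "length s = N" "length R = N" and n: "n < N"
    and pos: "\<And>j. j < N \<Longrightarrow> 0 < s ! j" and Rpos: "\<And>j. j < N \<Longrightarrow> 0 < R ! j"
    and A: "\<And>j. j < N \<Longrightarrow> A j \<in> carrier_mat (s ! j) (R ! j)" "\<And>j. j < N \<Longrightarrow> orthonormal_cols (A j)"
    and res: "tensor_norm2 s (\<lambda>i. X i - mode_prods G [0..<N] A i) \<le> 1 / 3 * tensor_norm2 s X"
  shows "tensor_norm2 s X \<le> 3 * tensor_norm2 (R[n := s ! n]) (ttm_except N {n} X A)"
proof -
  let ?Z = "mode_prods G [0..<N] A" and ?e = "R[n := s ! n]"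
  let ?Y = "ttm_except N {n} X A"
  have s: "s \<noteq> []" using len n by auto
  have "tensor_norm2 s X \<le> 2 / 3 * tensor_norm2 s X + tensor_norm2 ?e ?Y"
  proof (rule tensor_norm2_le[OF s])
    fix v assume v0: "v j \<in> unit_vecs (s ! j)" if "j < length s" for j
    have v: "v j \<in> carrier_vec (s ! j)" "vec_norm2 (v j) = 1" if "j < N" for j
      using v0[of j] that len by (auto simp: unit_vecs_def)
    \<comment> \<open>\<open>y\<close> collects the arguments handed to \<open>Y\<close>;
      \<open>w\<close> is \<open>v\<close> projected by \<open>A j\<close> times its transpose in
      every mode except \<open>n\<close>.\<close>
    define y where "y j = (if j = n then v n else (A j)\<^sup>T *\<^sub>v v j)" for j
    define w where "w j = (if j = n then v n else A j *\<^sub>v y j)" for j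
    have yn: "y n \<in> carrier_vec (s ! n)"
      using v(1)[OF n] by (simp add: y_def)
    have yR: "y j \<in> carrier_vec (R ! j)" if "j < N" "j \<noteq> n" for j
      using that v[OF that(1)] A[OF that(1)] by (simp add: y_def)
    have y1: "vec_norm2 (y j) \<le> 1" if "j < N" for j
      using that v[OF that] vec_norm2_transpose_orthonormal_cols[OF A[OF that] v(1)[OF that]]
      by (auto simp: y_def)
    have w: "w j \<in> carrier_vec (s ! j)" "vec_norm2 (w j) \<le> 1" if "j < N" for j
      using that v[OF that] A[OF that] yR[OF that] y1[OF that]
        vec_norm2_orthonormal_cols[OF A[OF that], of "y j"]
      by (auto simp: w_def)
    \<comment> \<open>The reconstruction sees its arguments only through the transposed factors,
      which cannot tell \<open>w\<close> from \<open>v\<close>.\<close>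
    have Z: "multilinear_form s ?Z u = multilinear_form R G (\<lambda>j. (A j)\<^sup>T *\<^sub>v u j)"
      if "\<And>j. j < N \<Longrightarrow> u j \<in> carrier_vec (s ! j)" for u
    proof -
      have "multilinear_form s ?Z u = multilinear_form R G
          (\<lambda>j. if j \<in> set [0..<N] then (A j)\<^sup>T *\<^sub>v u j else u j)"
        using that len A by (intro multilinear_form_mode_prods) auto
      also have "\<dots> = multilinear_form R G (\<lambda>j. (A j)\<^sup>T *\<^sub>v u j)"
        using len by (intro multilinear_form_cong) auto
      finally show ?thesis .
    qed
    have proj: "(A j)\<^sup>T *\<^sub>v w j = (A j)\<^sup>T *\<^sub>v v j" if "j < N" for j
    proof (cases "j = n")
      case False
      have "(A j)\<^sup>T *\<^sub>v (A j *\<^sub>v y j) = ((A j)\<^sup>T * A j) *\<^sub>v y j"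
        using A[OF that] yR[OF that False]
        by (intro assoc_mult_mat_vec[symmetric]) auto
      also have "\<dots> = y j"
        using A[OF that] yR[OF that False]
        by (simp add: orthonormal_cols_def)
      finally show ?thesis using False by (simp add: w_def y_def)
    qed (simp add: w_def)
    have "multilinear_form s ?Z v = multilinear_form s ?Z w"
      using Z[OF v(1)] Z[OF w(1)] proj len by (auto intro!: multilinear_form_cong)
    then have "multilinear_form s X v = multilinear_form s (\<lambda>i. X i - ?Z i) v
        - multilinear_form s (\<lambda>i. X i - ?Z i) w + multilinear_form s X w"
      by (simp add: multilinear_form_diff_tensor)
    moreover have "multilinear_form ?e ?Y y = multilinear_form s X w"
    proof -
      have "multilinear_form ?e ?Y y =
          multilinear_form s X (\<lambda>j. if j \<in> {n} then y j else A j *\<^sub>v y j)"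
        using yR A len n by (intro multilinear_form_ttm_except) auto
      also have "\<dots> = multilinear_form s X w"
        by (intro multilinear_form_cong) (simp add: w_def y_def)
      finally show ?thesis .
    qed
    moreover have "\<bar>multilinear_form ?e ?Y y\<bar> \<le> tensor_norm2 ?e ?Y"
      using s yn yR y1 len n Rpos pos
      by (intro abs_multilinear_form_le_norm2) (auto simp: nth_list_update)
    moreover have "\<bar>multilinear_form s (\<lambda>i. X i - ?Z i) v\<bar> \<le> tensor_norm2 s (\<lambda>i. X i - ?Z i)"
      using v0 by (intro abs_multilinear_form_unit_le s)
    moreover have "\<bar>multilinear_form s (\<lambda>i. X i - ?Z i) w\<bar> \<le> tensor_norm2 s (\<lambda>i. X i - ?Z i)"
      using s w len pos by (intro abs_multilinear_form_le_norm2) auto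
    ultimately show "\<bar>multilinear_form s X v\<bar> \<le> 2 / 3 * tensor_norm2 s X + tensor_norm2 ?e ?Y"
      using res by linarith
  qed (use pos len in auto)
  then show ?thesis by simp
qed

text \<open>Evaluated at \<open>v\<close>, the approximation is the first-order expansion of the
  form of \<open>X\<close> at \<open>a\<close> with increments \<open>b\<close>, while
  \<open>Y\<close> gives the exact value at \<open>a + b\<close>. Mode \<open>n\<close> keeps
  \<open>v n\<close> and is never perturbed.\<close>

lemma tensor_norm2_pp_approx_error_le:
  assumes len: "length s = N" "length R = N" and n: "n < N"
    and pos: "\<And>j. j < N \<Longrightarrow> 0 < s ! j" "\<And>j. j < N \<Longrightarrow> 0 < R ! j"
    and carrier: "\<And>j. j < N \<Longrightarrow> Ap j \<in> carrier_mat (s ! j) (R ! j)"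
      "\<And>j. j < N \<Longrightarrow> dA j \<in> carrier_mat (s ! j) (R ! j)"
    and A: "\<And>j. j < N \<Longrightarrow> A j = Ap j + dA j"
    and orth: "\<And>j. j < N \<Longrightarrow> orthonormal_cols (A j)" "\<And>j. j < N \<Longrightarrow> orthonormal_cols (Ap j)"
    and small: "\<And>j. j < N \<Longrightarrow> mat_norm2 (dA j) \<le> \<epsilon>"
  shows "tensor_norm2 (R[n := s ! n]) (\<lambda>i. pp_approx N n X Ap dA i - ttm_except N {n} X A i)
    \<le> (real N)\<^sup>2 * (tensor_norm2 s X * \<epsilon>\<^sup>2)"
proof (rule tensor_norm2_le)
  let ?e = "R[n := s ! n]" and ?J = "{..<N} - {n}"
  show "?e \<noteq> []" using len n by auto
  show "0 < ?e ! j" if "j < length ?e" for j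
    using that len n pos by (auto simp: nth_list_update)
  fix v assume "v j \<in> unit_vecs (?e ! j)" if "j < length ?e" for j
  then have v: "v j \<in> unit_vecs (?e ! j)" if "j < N" for j
    using that len by simp
  have vn: "v n \<in> carrier_vec (s ! n)" "vec_norm2 (v n) = 1"
    using v[OF n] n len by (auto simp: unit_vecs_def)
  have vR: "v j \<in> unit_vecs (R ! j)" "v j \<in> carrier_vec (R ! j)" "vec_norm2 (v j) = 1" if "j \<in> ?J" for j
    using v[of j] that by (auto simp: unit_vecs_def)
  define a where "a j = (if j = n then v n else Ap j *\<^sub>v v j)" for j
  define b where "b j = dA j *\<^sub>v v j" for j
  have Ac: "A j \<in> carrier_mat (s ! j) (R ! j)" if "j < N" for j
    using carrier[OF that] A[OF that] by simp
  have a: "a j \<in> carrier_vec (s ! j)" "vec_norm2 (a j) \<le> 1" if "j < N" for j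
    using that vn vR[of j] carrier(1)[OF that]
      vec_norm2_orthonormal_cols[OF carrier(1)[OF that] orth(2)[OF that], of "v j"]
    by (auto simp: a_def)
  have b: "b j \<in> carrier_vec (s ! j)" "vec_norm2 (b j) \<le> \<epsilon>" if "j \<in> ?J" for j
  proof -
    have j: "j < N" using that by simp
    show "b j \<in> carrier_vec (s ! j)" using vR[OF that] carrier(2)[OF j] by (simp add: b_def)
    show "vec_norm2 (b j) \<le> \<epsilon>"
      unfolding b_def
      using vec_norm2_mult_mat_vec_le[OF carrier(2)[OF j] vR(1)[OF that]] small[OF j] by linarith
  qed
  have ab: "a j + b j = A j *\<^sub>v v j" if "j \<in> ?J" for j
    using that vR[OF that] carrier[of j] A[of j]
    by (simp add: a_def b_def add_mult_distrib_mat_vec[of _ "s ! j" "R ! j"])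
  \<comment> \<open>\<open>a j + b j\<close> is the image of a unit vector under the isometry
    \<open>A j\<close>, so the perturbation causes no growth.\<close>
  have ab_le: "vec_norm2 (a j + b j) \<le> 1" if "j \<in> ?J" for j
    using that vR[OF that] vec_norm2_orthonormal_cols[OF Ac orth(1), of j "v j"]
    by (simp add: ab)
  have Y: "multilinear_form ?e (ttm_except N {n} X A) v =
      multilinear_form s X (\<lambda>j. if j \<in> ?J then a j + b j else a j)"
    using len n Ac vR ab
    by (subst multilinear_form_ttm_except[of s]) (auto simp: a_def intro!: multilinear_form_cong)
  have Yp: "multilinear_form ?e (ttm_except N {n} X Ap) v = multilinear_form s X a"
    using len n carrier vR
    by (subst multilinear_form_ttm_except[of s]) (auto simp: a_def intro!: multilinear_form_cong)
  have Yi: "multilinear_form ?e (mode_prod (ttm_except N {i, n} X Ap) i ((dA i)\<^sup>T)) v =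
      multilinear_form s X (a(i := b i))" if i: "i \<in> ?J" for i
  proof -
    \<comment> \<open>The pairwise operator keeps the original dimension in both modes
      \<open>i\<close> and \<open>n\<close>; the product with the transpose of \<open>dA i\<close>
      then restores \<open>R ! i\<close>.\<close>
    let ?d = "?e[i := s ! i]"
    have e: "?e = ?d[i := R ! i]" using i by (simp add: list_update_swap)
    have "multilinear_form ?e (mode_prod (ttm_except N {i, n} X Ap) i ((dA i)\<^sup>T)) v =
        multilinear_form (?d[i := R ! i]) (mode_prod (ttm_except N {i, n} X Ap) i ((dA i)\<^sup>T)) v"
      using e by simp
    also have "\<dots> = multilinear_form ?d (ttm_except N {i, n} X Ap) (v(i := (dA i)\<^sup>T\<^sup>T *\<^sub>v v i))"
      using i len carrier vR[OF i] by (intro multilinear_form_mode_prod) auto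
    also have "\<dots> = multilinear_form s X
        (\<lambda>j. if j \<in> {i, n} then (v(i := b i)) j else Ap j *\<^sub>v (v(i := b i)) j)"
      unfolding b_def transpose_transpose using i n len carrier vR
      by (intro multilinear_form_ttm_except) (auto simp: nth_list_update)
    also have "\<dots> = multilinear_form s X (a(i := b i))"
      using i by (intro multilinear_form_cong) (auto simp: a_def)
    finally show ?thesis .
  qed
  \<comment> \<open>The remainder lemma subtracts the expansion from the exact value, hence the
    minus sign.\<close>
  have "multilinear_form ?e (\<lambda>i. pp_approx N n X Ap dA i - ttm_except N {n} X A i) v =
      - (multilinear_form s X (\<lambda>j. if j \<in> ?J then a j + b j else a j) - multilinear_form s X a
         - (\<Sum>i\<in>?J. multilinear_form s X (a(i := b i))))"
    unfolding pp_approx_def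
    by (simp only: multilinear_form_diff_tensor multilinear_form_add_tensor
        multilinear_form_sum_tensor Y Yp) (simp add: Yi)
  then have "\<bar>multilinear_form ?e (\<lambda>i. pp_approx N n X Ap dA i - ttm_except N {n} X A i) v\<bar> =
      \<bar>multilinear_form s X (\<lambda>j. if j \<in> ?J then a j + b j else a j) - multilinear_form s X a
         - (\<Sum>i\<in>?J. multilinear_form s X (a(i := b i)))\<bar>"
    by simp
  also have "\<dots> \<le> (real (card ?J))\<^sup>2 * (tensor_norm2 s X * \<epsilon>\<^sup>2)"
    using len n pos a b ab_le
    by (intro multilinear_form_first_order_error tensor_norm2_nonneg) auto
  also have "\<dots> \<le> (real N)\<^sup>2 * (tensor_norm2 s X * \<epsilon>\<^sup>2)"
    using len n pos card_mono[of "{..<N}" ?J]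
    by (intro mult_right_mono power_mono mult_nonneg_nonneg tensor_norm2_nonneg) auto
  finally show "\<bar>multilinear_form ?e (\<lambda>i. pp_approx N n X Ap dA i - ttm_except N {n} X A i) v\<bar>
      \<le> (real N)\<^sup>2 * (tensor_norm2 s X * \<epsilon>\<^sup>2)" .
qed

section \<open>The relative error\<close>

theorem theorem4p6:
  fixes N :: nat
  shows "\<exists>C>0. \<exists>\<epsilon>\<^sub>0>0.
    \<forall>(s :: nat list) (R :: nat list) (X :: tensor) (G :: tensor)
      (A :: nat \<Rightarrow> real mat) (Ap :: nat \<Rightarrow> real mat) (dA :: nat \<Rightarrow> real mat) (\<epsilon> :: real).
      length s = N \<longrightarrow> length R = N \<longrightarrow>
      (\<forall>j<N. 0 < s ! j \<and> 0 < R ! j) \<longrightarrow>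
      (\<exists>i\<in>multi_indices s. X i \<noteq> 0) \<longrightarrow>
      (\<forall>j<N. A j \<in> carrier_mat (s ! j) (R ! j) \<and> Ap j \<in> carrier_mat (s ! j) (R ! j)
           \<and> dA j \<in> carrier_mat (s ! j) (R ! j)) \<longrightarrow>
      (\<forall>j<N. A j = Ap j + dA j) \<longrightarrow>
      (\<forall>j<N. orthonormal_cols (A j) \<and> orthonormal_cols (Ap j)) \<longrightarrow>
      \<epsilon> \<le> \<epsilon>\<^sub>0 \<longrightarrow>
      (\<forall>j<N. mat_norm2 (dA j) \<le> \<epsilon>) \<longrightarrow>
      tensor_norm2 s (\<lambda>i. X i - mode_prods G [0..<N] A i) \<le> 1 / 3 * tensor_norm2 s X \<longrightarrow>
      (\<forall>n<N. tensor_norm2 (R[n := s ! n]) (ttm_except N {n} X A) \<noteq> 0 \<and>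
        tensor_norm2 (R[n := s ! n])
            (\<lambda>i. pp_approx N n X Ap dA i - ttm_except N {n} X A i)
          / tensor_norm2 (R[n := s ! n]) (ttm_except N {n} X A)
        \<le> C * \<epsilon>\<^sup>2)"
\<comment> \<open>The factor 3 comes from the denominator and \<open>(real N)\<^sup>2\<close> from
  the numerator; adding 1 keeps the constant positive when \<open>N = 0\<close>.\<close>
proof (rule exI[of _ "3 * (real N)\<^sup>2 + 1"], intro conjI exI[of _ 1] allI impI)
  fix s R X G A Ap dA and \<epsilon> :: real and n :: nat
  assume len: "length s = N" "length R = N" and n: "n < N"
    and pos: "\<forall>j<N. 0 < s ! j \<and> 0 < R ! j"
    and X: "\<exists>i\<in>multi_indices s. X i \<noteq> 0"
    and carrier: "\<forall>j<N. A j \<in> carrier_mat (s ! j) (R ! j) \<and> Ap j \<in> carrier_mat (s ! j) (R ! j)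
           \<and> dA j \<in> carrier_mat (s ! j) (R ! j)"
    and A: "\<forall>j<N. A j = Ap j + dA j"
    and orth: "\<forall>j<N. orthonormal_cols (A j) \<and> orthonormal_cols (Ap j)"
    and small: "\<forall>j<N. mat_norm2 (dA j) \<le> \<epsilon>"
    and res: "tensor_norm2 s (\<lambda>i. X i - mode_prods G [0..<N] A i) \<le> 1 / 3 * tensor_norm2 s X"
  let ?e = "R[n := s ! n]"
  let ?Y = "tensor_norm2 ?e (ttm_except N {n} X A)"
  let ?D = "tensor_norm2 ?e (\<lambda>i. pp_approx N n X Ap dA i - ttm_except N {n} X A i)"
  have XY: "tensor_norm2 s X \<le> 3 * ?Y"
    using len n pos carrier orth res by (intro tensor_norm2_le_ttm_except) auto
  have "0 < tensor_norm2 s X"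
    using X len n by (auto intro: tensor_norm2_pos)
  with XY have Y: "0 < ?Y" by linarith
  then show "?Y \<noteq> 0" by simp
  have "?D \<le> (real N)\<^sup>2 * (tensor_norm2 s X * \<epsilon>\<^sup>2)"
    by (rule tensor_norm2_pp_approx_error_le) (use len n pos carrier A orth small in auto)
  also have "\<dots> \<le> (real N)\<^sup>2 * (3 * ?Y * \<epsilon>\<^sup>2)"
    using XY by (intro mult_left_mono mult_right_mono) auto
  also have "\<dots> \<le> (3 * (real N)\<^sup>2 + 1) * \<epsilon>\<^sup>2 * ?Y"
    using Y by (simp add: algebra_simps)
  finally show "?D / ?Y \<le> (3 * (real N)\<^sup>2 + 1) * \<epsilon>\<^sup>2"
    using Y by (simp add: pos_divide_le_eq)
qed (auto intro: add_nonneg_pos)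

end
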